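(* Let $q,m\in\mathbb{N}=\{1,2,\dots\}$ be fixed. As $x\to\infty$, $$L^q_m(x)\sim\frac{q\,\bigl(\Gamma(1+1/q)\bigr)^m\,x^{m/q}}{m!\;m\;\Gamma(m/q)}.$$ In particular, for $q=1$ and $q=2$, respectively, $$L^1_m(x)\sim\frac{x^m}{m!\,m!},\qquad L^2_m(x)\sim\frac{\pi^{m/2}\,x^{m/2}}{2^{m-1}\,m!\;m\;\Gamma(m/2)}.$$
   Context: For $x>0$, $L^q_m(x)$ denotes the number of integer solutions $(j_1,\dots,j_m)$ of the inequality $j_1^q+\dots+j_m^q\le x$ with $j_1>j_2>\dots>j_m>0$; equivalently, the number of partitions of integers $n\le x$ into exactly $m$ distinct parts, each a perfect $q$-th power of a positive integer. $a\sim b$ means $a/b\to1$. *)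

theory Defs
  imports "HOL-Analysis.Analysis" "HOL-Library.Landau_Symbols"
begin

text \<open>Integer \<open>m\<close>-tuples \<open>(j\<^sub>1, \<dots>, j\<^sub>m)\<close> are lists of length \<open>m\<close>; with \<open>sorted_wrt (>)\<close> the
  list is strictly decreasing.\<close>

definition power_solutions :: "nat \<Rightarrow> nat \<Rightarrow> real \<Rightarrow> int list set" where
  "power_solutions q m x =
     {js. length js = m \<and> sorted_wrt (>) js \<and> (\<forall>j\<in>set js. j > 0)
          \<and> real_of_int (\<Sum>j\<leftarrow>js. j ^ q) \<le> x}"

definition L :: "nat \<Rightarrow> nat \<Rightarrow> real \<Rightarrow> nat" where
  "L q m x = card (power_solutions q m x)"

text \<open>The set is finite, so its \<open>card\<close> is its number of elements.\<close>

lemma finite_power_solutions: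
  assumes "q \<ge> 1"
  shows "finite (power_solutions q m x)"
proof (rule finite_subset)
  show "power_solutions q m x \<subseteq> {js. set js \<subseteq> {0..\<lfloor>x\<rfloor>} \<and> length js = m}"
  proof (clarsimp simp: power_solutions_def)
    fix js :: "int list" and j
    assume pos: "\<forall>j\<in>set js. 0 < j" and le: "real_of_int (\<Sum>j\<leftarrow>js. j ^ q) \<le> x"
      and j: "j \<in> set js"
    have "j \<le> j ^ q"
      using assms pos j by (intro self_le_power) force+
    also have "\<dots> \<le> (\<Sum>j\<leftarrow>js. j ^ q)"
      using pos j by (intro member_le_sum_list) (auto intro: less_imp_le)
    also have "\<dots> \<le> \<lfloor>x\<rfloor>" using le by (simp only: le_floor_iff)
    finally have "j \<le> \<lfloor>x\<rfloor>" .
    then show "0 \<le> j \<and> j \<le> \<lfloor>x\<rfloor>" using pos j by force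
  qed
qed (rule finite_lists_length_eq, simp)

end

theory Submission
  imports Defs "HOL-Combinatorics.Multiset_Permutations"
begin

text \<open>
  Every solution counted by \<open>L q m x\<close> has \<open>m!\<close> orderings, so it suffices to count tuples with
  distinct entries; call their number \<open>D m x\<close>. Splitting off the first entry \<open>k\<close> shows that
  \<open>D (m + 1) x\<close> is the sum of \<open>D m (x - k^q)\<close> over \<open>1 \<le> k \<le> x powr (1/q)\<close>, up to an error of
  at most \<open>m * D m x\<close> caused by the tuples that already contain \<open>k\<close>. If \<open>D m x\<close> is
  \<open>c x powr (m/q)\<close> up to lower order, this sum is compared with the integral of
  \<open>c (x - t^q) powr (m/q)\<close> over \<open>[0, x powr (1/q)]\<close>, a Beta integral. By induction on \<open>m\<close> the
  constant is \<open>Gamma (1 + 1/q) ^ m / Gamma (1 + m/q)\<close>, the volume of the region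
  \<open>t\<^sub>1^q + \<dots> + t\<^sub>m^q \<le> 1\<close> in the positive orthant.
\<close>

section \<open>Decreasing tuples and their orderings\<close>

definition distinct_solutions :: "nat \<Rightarrow> nat \<Rightarrow> real \<Rightarrow> int list set" where
  "distinct_solutions q m x =
     {js. length js = m \<and> distinct js \<and> (\<forall>j\<in>set js. j > 0)
          \<and> real_of_int (\<Sum>j\<leftarrow>js. j ^ q) \<le> x}"

lemma sorted_wrt_greater_eqI:
  fixes xs ys :: "'a :: linorder list"
  assumes "sorted_wrt (>) xs" "sorted_wrt (>) ys" "set xs = set ys"
  shows "xs = ys"
proof -
  have "rev xs = rev ys"
    by (rule strict_sorted_equal) (use assms in \<open>auto simp: sorted_wrt_rev\<close>)
  thus ?thesis by simp
qed

text \<open>Sorting a tuple with distinct entries into decreasing order changes neither its entry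
  set nor, the entries being distinct, its length or power sum, since both depend only on that
  set.\<close>

lemma distinct_solutions_eq_UN:
  "distinct_solutions q m x = (\<Union>js\<in>power_solutions q m x. permutations_of_set (set js))"
proof (intro equalityI subsetI)
  fix ys assume ys: "ys \<in> distinct_solutions q m x"
  define js where "js = rev (sorted_list_of_set (set ys))"
  have d: "distinct js" and s: "set js = set ys" by (auto simp: js_def)
  have "sorted_wrt (>) js"
    by (simp add: js_def sorted_wrt_rev strict_sorted_list_of_set)
  moreover have "length js = m"
    using ys d s by (metis (mono_tags, lifting) distinct_card distinct_solutions_def mem_Collect_eq)
  moreover have "(\<Sum>j\<leftarrow>js. j ^ q) = (\<Sum>j\<leftarrow>ys. j ^ q)"
    using ys d s by (simp add: sum_list_distinct_conv_sum_set distinct_solutions_def)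
  ultimately have "js \<in> power_solutions q m x"
    using ys s by (auto simp: power_solutions_def distinct_solutions_def)
  moreover have "ys \<in> permutations_of_set (set js)"
    using ys s by (auto simp: permutations_of_set_def distinct_solutions_def)
  ultimately show "ys \<in> (\<Union>js\<in>power_solutions q m x. permutations_of_set (set js))" by blast
next
  fix ys assume "ys \<in> (\<Union>js\<in>power_solutions q m x. permutations_of_set (set js))"
  then obtain js where js: "js \<in> power_solutions q m x" and ys: "set ys = set js" "distinct ys"
    by (auto simp: permutations_of_set_def)
  have d: "distinct js"
    using js strict_sorted_iff[of "rev js"] by (auto simp: power_solutions_def sorted_wrt_rev)
  have "length ys = length js" using ys d by (metis distinct_card)
  moreover have "(\<Sum>j\<leftarrow>ys. j ^ q) = (\<Sum>j\<leftarrow>js. j ^ q)"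
    using ys d by (simp add: sum_list_distinct_conv_sum_set)
  ultimately show "ys \<in> distinct_solutions q m x"
    using js ys by (auto simp: power_solutions_def distinct_solutions_def)
qed

lemma finite_distinct_solutions: "q \<ge> 1 \<Longrightarrow> finite (distinct_solutions q m x)"
  by (simp add: distinct_solutions_eq_UN finite_power_solutions)

text \<open>A decreasing tuple is determined by its entry set, so the union over
  \<open>power_solutions\<close> is disjoint, and each entry set has \<open>m\<close>
  elements.\<close>

lemma card_distinct_solutions:
  assumes "q \<ge> 1"
  shows "card (distinct_solutions q m x) = fact m * L q m x"
proof -
  have "card (distinct_solutions q m x)
      = (\<Sum>js\<in>power_solutions q m x. card (permutations_of_set (set js)))"
    unfolding distinct_solutions_eq_UN
  proof (rule card_UN_disjoint)
    show "\<forall>i\<in>power_solutions q m x. \<forall>j\<in>power_solutions q m x. i \<noteq> j \<longrightarrow>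
        permutations_of_set (set i) \<inter> permutations_of_set (set j) = {}"
    proof (intro ballI impI)
      fix i j assume "i \<in> power_solutions q m x" "j \<in> power_solutions q m x" "i \<noteq> j"
      hence "set i \<noteq> set j"
        using sorted_wrt_greater_eqI[of i j] by (auto simp: power_solutions_def)
      thus "permutations_of_set (set i) \<inter> permutations_of_set (set j) = {}"
        by (auto simp: permutations_of_set_def)
    qed
  qed (use assms in \<open>auto simp: finite_power_solutions\<close>)
  also have "\<dots> = (\<Sum>js\<in>power_solutions q m x. fact m)"
  proof (rule sum.cong)
    fix js assume js: "js \<in> power_solutions q m x"
    have "distinct js"
      using js strict_sorted_iff[of "rev js"] by (auto simp: power_solutions_def sorted_wrt_rev)
    thus "card (permutations_of_set (set js)) = fact m"
      using js by (simp add: distinct_card power_solutions_def)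
  qed simp
  finally show ?thesis by (simp add: L_def)
qed

section \<open>Splitting off the first entry\<close>

text \<open>Applied to the tail of a tuple with first entry \<open>k\<close>, this forces
  \<open>k ^ q \<le> x\<close> and so bounds the range of \<open>k\<close>.\<close>

lemma distinct_solutions_nonneg:
  assumes "js \<in> distinct_solutions q m x"
  shows "x \<ge> 0"
proof -
  have "0 \<le> (\<Sum>j\<leftarrow>js. j ^ q)"
    using assms by (intro sum_list_nonneg) (auto simp: distinct_solutions_def less_imp_le)
  hence "0 \<le> real_of_int (\<Sum>j\<leftarrow>js. j ^ q)" by linarith
  thus ?thesis using assms unfolding distinct_solutions_def by (metis (mono_tags, lifting) dual_order.trans mem_Collect_eq)
qed

lemma power_le_iff_le_floor_root:
  assumes "q \<ge> 1" "x \<ge> 0"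
  shows "real k ^ q \<le> x \<longleftrightarrow> k \<le> nat \<lfloor>root q x\<rfloor>"
proof -
  have "real k ^ q \<le> x \<longleftrightarrow> real k \<le> root q x"
    using assms real_root_le_iff[of q "real k ^ q" x] by (simp add: real_root_power_cancel)
  also have "\<dots> \<longleftrightarrow> k \<le> nat \<lfloor>root q x\<rfloor>"
    using assms by (simp add: le_nat_iff le_floor_iff)
  finally show ?thesis .
qed

text \<open>The tail may contain \<open>k\<close> again, so prefixing \<open>k\<close> can produce
  tuples with a repeated entry.\<close>

definition first_part_pairs :: "nat \<Rightarrow> nat \<Rightarrow> real \<Rightarrow> (nat \<times> int list) set" where
  "first_part_pairs q m x =
     (SIGMA k:{1..nat \<lfloor>root q x\<rfloor>}. distinct_solutions q m (x - real k ^ q))"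

lemma inj_on_first_part_pairs:
  "inj_on (\<lambda>(k, js). int k # js) (first_part_pairs q m x)"
  by (auto simp: inj_on_def)

lemma distinct_solutions_Suc_subset:
  assumes "q \<ge> 1" "x \<ge> 0"
  shows "distinct_solutions q (Suc m) x \<subseteq> (\<lambda>(k, js). int k # js) ` first_part_pairs q m x"
proof
  fix ys assume ys: "ys \<in> distinct_solutions q (Suc m) x"
  then obtain j js where [simp]: "ys = j # js" and len: "length js = m"
    by (auto simp: distinct_solutions_def length_Suc_conv)
  define k where "k = nat j"
  have j: "j = int k" "k \<ge> 1" using ys by (auto simp: distinct_solutions_def k_def)
  have js: "js \<in> distinct_solutions q m (x - real k ^ q)"
    using ys len by (auto simp: distinct_solutions_def j)
  have "k \<le> nat \<lfloor>root q x\<rfloor>"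
    using distinct_solutions_nonneg[OF js] power_le_iff_le_floor_root[OF assms, of k] by simp
  thus "ys \<in> (\<lambda>(k, js). int k # js) ` first_part_pairs q m x"
    using js j by (force simp: first_part_pairs_def)
qed

text \<open>If \<open>k\<close> recurs in the tail \<open>js\<close>, it is \<open>js ! i\<close>
  for some \<open>i < m\<close>, so \<open>i\<close> and \<open>js\<close> determine the tuple.
  There are at most \<open>m\<close> times as many such tuples as there are tails with bound
  \<open>x\<close>.\<close>

lemma first_part_pairs_subset:
  "(\<lambda>(k, js). int k # js) ` first_part_pairs q m x
     \<subseteq> distinct_solutions q (Suc m) x \<union> (\<lambda>(i, js). js ! i # js) ` ({..<m} \<times> distinct_solutions q m x)"
proof clarsimp
  fix k js
  assume "(k, js) \<in> first_part_pairs q m x"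
    and 2: "int k # js \<notin> (\<lambda>(i, js). js ! i # js) ` ({..<m} \<times> distinct_solutions q m x)"
  hence js: "js \<in> distinct_solutions q m (x - real k ^ q)" and k: "k \<ge> 1"
    by (auto simp: first_part_pairs_def)
  have "js \<in> distinct_solutions q m x"
    using js by (auto simp: distinct_solutions_def intro: order.trans)
  hence "int k \<notin> set js"
    using 2 by (force simp: in_set_conv_nth distinct_solutions_def)
  thus "int k # js \<in> distinct_solutions q (Suc m) x"
    using js k by (auto simp: distinct_solutions_def)
qed

lemma card_first_part_pairs:
  assumes "q \<ge> 1"
  shows "card (first_part_pairs q m x)
    = (\<Sum>k=1..nat \<lfloor>root q x\<rfloor>. card (distinct_solutions q m (x - real k ^ q)))"
  unfolding first_part_pairs_def
  using assms by (intro card_SigmaI) (auto simp: finite_distinct_solutions)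

lemma card_distinct_solutions_Suc_le:
  assumes "q \<ge> 1" "x \<ge> 0"
  shows "card (distinct_solutions q (Suc m) x)
    \<le> (\<Sum>k=1..nat \<lfloor>root q x\<rfloor>. card (distinct_solutions q m (x - real k ^ q)))"
proof -
  have fin: "finite (first_part_pairs q m x)"
    using assms by (auto simp: first_part_pairs_def finite_distinct_solutions)
  have "card (distinct_solutions q (Suc m) x)
      \<le> card ((\<lambda>(k, js). int k # js) ` first_part_pairs q m x)"
    using assms fin by (intro card_mono distinct_solutions_Suc_subset) auto
  thus ?thesis
    using assms by (simp add: card_image inj_on_first_part_pairs card_first_part_pairs)
qed

lemma card_distinct_solutions_Suc_ge:
  assumes "q \<ge> 1"
  shows "(\<Sum>k=1..nat \<lfloor>root q x\<rfloor>. card (distinct_solutions q m (x - real k ^ q)))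
    \<le> card (distinct_solutions q (Suc m) x) + m * card (distinct_solutions q m x)"
proof -
  have fin: "finite (distinct_solutions q m x)" "finite (distinct_solutions q (Suc m) x)"
    using assms by (auto simp: finite_distinct_solutions)
  have "card (first_part_pairs q m x) = card ((\<lambda>(k, js). int k # js) ` first_part_pairs q m x)"
    by (simp add: card_image inj_on_first_part_pairs)
  also have "\<dots> \<le> card (distinct_solutions q (Suc m) x
      \<union> (\<lambda>(i, js). js ! i # js) ` ({..<m} \<times> distinct_solutions q m x))"
    using fin by (intro card_mono first_part_pairs_subset) auto
  also have "\<dots> \<le> card (distinct_solutions q (Suc m) x)
      + card ((\<lambda>(i, js). js ! i # js) ` ({..<m} \<times> distinct_solutions q m x))"
    by (rule card_Un_le)
  also have "card ((\<lambda>(i, js). js ! i # js) ` ({..<m} \<times> distinct_solutions q m x))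
      \<le> card ({..<m} \<times> distinct_solutions q m x)"
    using fin by (intro card_image_le) auto
  finally show ?thesis
    using assms by (simp add: card_first_part_pairs card_cartesian_product)
qed

section \<open>The Beta integral and the constants\<close>

text \<open>The substitution \<open>t = r * v powr (1 / q)\<close> yields the Beta integrand. The
  truncation by \<open>max 0\<close> keeps the integrand nonnegative and decreasing beyond
  \<open>r\<close>, as the later comparison of sum and integral requires.\<close>

lemma integral_root_power:
  assumes q: "q \<ge> 1" and r: "r \<ge> 0"
  shows "integral {0..r} (\<lambda>t. root q (max 0 (r ^ q - t ^ q)) ^ m)
    = r ^ Suc m / real q * Beta (1 / real q) (real m / real q + 1)"
proof -
  define f where "f = (\<lambda>t. root q (max 0 (r ^ q - t ^ q)) ^ m)"
  define g where "g = (\<lambda>v. r * v powr (1 / real q))"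
  define g' where "g' = (\<lambda>v. r / real q * v powr (1 / real q - 1))"
  have le1: "v powr (1 / real q) \<le> 1" if "v \<in> {0..1}" for v
    using that powr_mono2[of "1 / real q" v 1] by auto
  have I: "((\<lambda>v. g' v *\<^sub>R f (g v)) has_integral (integral {g 0..g 1} f)) {0..1}"
  \<comment> \<open>At 0 the derivative formula fails: \<open>g\<close> has infinite slope there for
    \<open>q > 1\<close> and \<open>r > 0\<close>, and for \<open>q = 1\<close> the formula contains
    \<open>0 powr 0 = 0\<close>.\<close>
  proof (rule has_integral_substitution_strong[of "{0}" _ _ _ 0 r])
    show "g ` {0..1} \<subseteq> {0..r}"
      using r le1 by (auto simp: g_def mult_left_le)
    show "continuous_on {0..r} f"
      unfolding f_def by (intro continuous_intros)
    show "continuous_on {0..1} g"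
      unfolding g_def using q by (intro continuous_intros continuous_on_powr') auto
    show "(g has_real_derivative g' v) (at v within {0..1})" if "v \<in> {0..1} - {0}" for v
      unfolding g_def g'_def using that q
      by (auto intro!: derivative_eq_intros)
  qed (use q r in \<open>auto simp: g_def\<close>)
  have "((\<lambda>v. r ^ Suc m / real q * (v powr (1 / real q - 1)
      * (1 - v) powr (real m / real q + 1 - 1))) has_integral (integral {g 0..g 1} f)) {0..1}"
  \<comment> \<open>The endpoint 1 must be excluded for \<open>m = 0\<close>, where
    \<open>0 powr 0 = 0\<close> but \<open>0 ^ 0 = 1\<close>.\<close>
  proof (rule has_integral_spike_finite[OF _ _ I, where S = "{0, 1}"])
    fix v :: real assume v: "v \<in> {0..1} - {0, 1}"
    have "r ^ q - g v ^ q = r ^ q * (1 - v)"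
      using v q by (simp add: g_def power_mult_distrib powr_power algebra_simps)
    moreover have "r ^ q * (1 - v) \<ge> 0" using v r by simp
    ultimately have "f (g v) = (r * root q (1 - v)) ^ m"
      using q r by (simp add: f_def max.absorb2 real_root_mult real_root_power_cancel)
    also have "\<dots> = r ^ m * (1 - v) powr (real m / real q)"
      using v q by (simp add: power_mult_distrib root_powr_inverse powr_power)
    finally show "r ^ Suc m / real q * (v powr (1 / real q - 1)
      * (1 - v) powr (real m / real q + 1 - 1)) = g' v *\<^sub>R f (g v)"
      by (simp add: g'_def)
  qed simp
  moreover have "((\<lambda>v. r ^ Suc m / real q * (v powr (1 / real q - 1)
      * (1 - v) powr (real m / real q + 1 - 1))) has_integral
      (r ^ Suc m / real q * Beta (1 / real q) (real m / real q + 1))) {0..1}"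
    using q by (intro has_integral_mult_right has_integral_Beta_real) (auto intro: add_nonneg_pos)
  ultimately have "integral {g 0..g 1} f = r ^ Suc m / real q * Beta (1 / real q) (real m / real q + 1)"
    by (rule has_integral_unique)
  thus ?thesis by (simp add: f_def g_def)
qed

definition tuple_const :: "nat \<Rightarrow> nat \<Rightarrow> real" where
  "tuple_const q m = Gamma (1 + 1 / real q) ^ m / Gamma (1 + real m / real q)"

lemma Gamma_one_plus:
  fixes x :: real
  assumes "x > 0"
  shows "Gamma (1 + x) = x * Gamma x"
proof -
  have "x \<notin> \<int>\<^sub>\<le>\<^sub>0" using assms nonpos_Ints_nonpos[of x] by auto
  thus ?thesis using Gamma_plus1[of x] by (simp add: add_ac)
qed

lemma tuple_const_pos: "tuple_const q m > 0"
  unfolding tuple_const_def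
  by (intro divide_pos_pos zero_less_power Gamma_real_pos) (auto intro: add_pos_nonneg)

text \<open>Written in Gamma values, the Beta factor cancels the old denominator
  \<open>Gamma (1 + m / q)\<close> and supplies the new one; its remaining
  \<open>Gamma (1 / q) / q\<close> is \<open>Gamma (1 + 1 / q)\<close>.\<close>

lemma tuple_const_Suc:
  assumes "q \<ge> 1"
  shows "tuple_const q (Suc m) = tuple_const q m * (Beta (1 / real q) (real m / real q + 1) / real q)"
proof -
  have "Gamma (1 + real m / real q) > 0" "Gamma (1 + real (Suc m) / real q) > 0"
    by (auto intro!: Gamma_real_pos add_pos_nonneg)
  moreover have "Gamma (1 + 1 / real q) = Gamma (1 / real q) / real q"
    using assms Gamma_one_plus[of "1 / real q"] by simp
  moreover have "1 / real q + (real m / real q + 1) = 1 + real (Suc m) / real q"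
    by (simp add: add_divide_distrib)
  ultimately show ?thesis
    by (simp add: tuple_const_def Beta_def field_simps)
qed

section \<open>Comparison of the sum with the integral\<close>

text \<open>The summand \<open>f\<close> decreases, so the sum over \<open>0..n\<close> exceeds the
  integral over \<open>[0, n]\<close> by at most \<open>f 0 = r ^ m\<close>. Removing the term at 0
  makes the sum at most that integral, and the leftover integral over \<open>[n, r]\<close> lies
  between 0 and \<open>f 0\<close>; this gives the constant 2.\<close>

lemma sum_root_power_bounds:
  fixes q m :: nat and x :: real
  assumes q: "q \<ge> 1" and x: "x \<ge> 0"
  defines "r \<equiv> root q x"
  defines "I \<equiv> r ^ Suc m / real q * Beta (1 / real q) (real m / real q + 1)"
  shows "(\<Sum>k=1..nat \<lfloor>r\<rfloor>. root q (x - real k ^ q) ^ m) \<in> {I - 2 * r ^ m..I}"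
proof -
  define f where "f = (\<lambda>t. root q (max 0 (r ^ q - t ^ q)) ^ m)"
  define n where "n = nat \<lfloor>r\<rfloor>"
  have r: "r \<ge> 0" "r ^ q = x" using q x by (auto simp: r_def)
  have n: "real n \<le> r" "r \<le> real n + 1" using r by (auto simp: n_def)
  interpret antimono_fun_sum_integral_diff f
  proof
    show "f y \<le> f x" if "0 \<le> x" "x \<le> y" for x y
      unfolding f_def using that q r by (intro power_mono real_root_le_mono max.mono diff_mono) auto
    show "continuous_on {0..} f"
      unfolding f_def by (intro continuous_intros)
  qed (auto simp: f_def intro!: zero_le_power real_root_ge_zero)
  have int: "f integrable_on {a..b}" if "a \<ge> 0" for a b
    using that by (intro integrable_continuous_real continuous_on_subset[OF cont]) auto
  have f0: "f 0 = r ^ m" using q r by (simp add: f_def power_0_left real_root_power_cancel r_def)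
  have I: "integral {0..r} f = I"
    unfolding f_def I_def using q r by (intro integral_root_power) auto
  have split: "I = integral {0..real n} f + integral {real n..r} f"
    unfolding I[symmetric] using n by (intro Henstock_Kurzweil_Integration.integral_combine[symmetric] int) auto
  have ge: "integral {real n..r} f \<ge> 0"
    by (intro integral_nonneg int nonneg) auto
  have "integral {real n..r} f \<le> integral {real n..r} (\<lambda>_. f 0)"
    by (intro integral_le int dec) auto
  also have "\<dots> = (r - real n) * f 0" using n by simp
  also have "\<dots> \<le> 1 * f 0" using n nonneg[of 0] by (intro mult_right_mono) auto
  finally have le: "integral {real n..r} f \<le> f 0" by simp
  have "{..n} = insert 0 {1..n}" by auto
  hence "(\<Sum>k\<le>n. f (real k)) = f 0 + (\<Sum>k=1..n. f (real k))" by simp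
  moreover have "(\<Sum>k=1..n. f (real k)) = (\<Sum>k=1..n. root q (x - real k ^ q) ^ m)"
    using q x by (intro sum.cong)
      (auto simp: f_def r(2) max_def power_le_iff_le_floor_root n_def r_def)
  ultimately have "(\<Sum>k=1..n. root q (x - real k ^ q) ^ m)
      = sum_integral_diff_series n + integral {0..real n} f - f 0"
    by (simp add: sum_integral_diff_series_def)
  \<comment> \<open>The difference of sum and integral is decreasing in \<open>n\<close> and starts
    at \<open>f 0\<close>.\<close>
  moreover have "sum_integral_diff_series n \<le> f 0"
    using sum_integral_diff_series_antimono[of 0 n] by (simp add: sum_integral_diff_series_def)
  ultimately show ?thesis
    using sum_integral_diff_series_nonneg[of n] ge le split f0 unfolding n_def by auto
qed

section \<open>Upper and lower bounds by induction on the number of parts\<close>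

text \<open>
  Working with \<open>root q x ^ m\<close> instead of \<open>x powr (m / q)\<close> makes the bound valid for \<open>x = 0\<close>,
  \<open>m = 0\<close> too (\<open>0 powr 0 = 0\<close>), which the recursion reaches when \<open>x\<close> is a \<open>q\<close>-th power.
\<close>

lemma card_distinct_solutions_le:
  assumes q: "q \<ge> 1" and "x \<ge> 0"
  shows "real (card (distinct_solutions q m x)) \<le> tuple_const q m * root q x ^ m"
  using assms(2)
proof (induction m arbitrary: x)
  case 0
  have "distinct_solutions q 0 x = {[]}" using 0 by (auto simp: distinct_solutions_def)
  thus ?case by (simp add: tuple_const_def)
next
  case (Suc m)
  define n where "n = nat \<lfloor>root q x\<rfloor>"
  have "real (card (distinct_solutions q (Suc m) x))
      \<le> (\<Sum>k=1..n. real (card (distinct_solutions q m (x - real k ^ q))))"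
    using card_distinct_solutions_Suc_le[OF q Suc.prems, of m] unfolding n_def
    by (metis of_nat_mono of_nat_sum)
  also have "\<dots> \<le> (\<Sum>k=1..n. tuple_const q m * root q (x - real k ^ q) ^ m)"
    using power_le_iff_le_floor_root[OF q Suc.prems] by (intro sum_mono Suc.IH) (auto simp: n_def)
  also have "\<dots> = tuple_const q m * (\<Sum>k=1..n. root q (x - real k ^ q) ^ m)"
    by (simp add: sum_distrib_left)
  \<comment> \<open>The upper half of the comparison has no error term, so the induction loses
    nothing.\<close>
  also have "\<dots> \<le> tuple_const q m *
      (root q x ^ Suc m / real q * Beta (1 / real q) (real m / real q + 1))"
    using sum_root_power_bounds[OF q Suc.prems, of m] tuple_const_pos[of q m]
    by (intro mult_left_mono) (auto simp: n_def)
  finally show ?case by (simp add: tuple_const_Suc[OF q] mult_ac)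
qed

text \<open>
  The factor \<open>real m\<close> makes the error term vanish for \<open>m = 0\<close>, where \<open>m - 1\<close> is truncated.
\<close>

lemma card_distinct_solutions_ge:
  assumes q: "q \<ge> 1"
  shows "\<exists>K\<ge>0. \<forall>x\<ge>0. real (card (distinct_solutions q m x))
    \<ge> tuple_const q m * root q x ^ m - real m * K * root q x ^ (m - 1)"
proof (induction m)
  case 0
  have "distinct_solutions q 0 x = {[]}" if "x \<ge> 0" for x
    using that by (auto simp: distinct_solutions_def)
  thus ?case by (intro exI[of _ 0]) (simp add: tuple_const_def)
next
  case (Suc m)
  then obtain K where K: "K \<ge> 0" "\<And>x. x \<ge> 0 \<Longrightarrow> real (card (distinct_solutions q m x))
    \<ge> tuple_const q m * root q x ^ m - real m * K * root q x ^ (m - 1)" by blast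
  define c where "c = tuple_const q m"
  have c: "c > 0" by (simp add: c_def tuple_const_pos)
  \<comment> \<open>The three terms pay for the comparison with the integral, the accumulated errors
    of the induction hypothesis over \<open>n \<le> r\<close> summands, and the tuples repeating
    their first entry.\<close>
  define K' where "K' = 2 * c + real m * K + real m * c"
  have K': "K' \<ge> 0" using c K by (simp add: K'_def)
  have "real (card (distinct_solutions q (Suc m) x))
      \<ge> tuple_const q (Suc m) * root q x ^ Suc m - real (Suc m) * K' * root q x ^ m"
    if x: "x \<ge> 0" for x
  proof -
    define r where "r = root q x"
    define n where "n = nat \<lfloor>root q x\<rfloor>"
    define I where "I = r ^ Suc m / real q * Beta (1 / real q) (real m / real q + 1)"
    have r: "r \<ge> 0" "real n \<le> r" using q x by (auto simp: r_def n_def)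
    \<comment> \<open>The error at \<open>x - k ^ q\<close> is at most the error at
      \<open>x\<close>, uniformly in \<open>k\<close>.\<close>
    have E: "real m * K * root q (x - real k ^ q) ^ (m - 1) \<le> real m * K * r ^ (m - 1)"
      if "k \<in> {1..n}" for k
      using that power_le_iff_le_floor_root[OF q x, of k] K q unfolding r_def n_def
      by (intro mult_left_mono power_mono real_root_le_mono real_root_ge_zero) auto
    have "c * I - 2 * c * r ^ m - real m * K * r ^ m
        \<le> c * (\<Sum>k=1..n. root q (x - real k ^ q) ^ m) - real n * (real m * K * r ^ (m - 1))"
    proof -
      have "c * (I - 2 * r ^ m) \<le> c * (\<Sum>k=1..n. root q (x - real k ^ q) ^ m)"
        using sum_root_power_bounds[OF q x, of m] c
        by (intro mult_left_mono) (auto simp: n_def I_def r_def)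
      moreover have "c * (I - 2 * r ^ m) = c * I - 2 * c * r ^ m"
        by (simp add: algebra_simps)
      moreover have "real n * (real m * K * r ^ (m - 1)) \<le> r * (real m * K * r ^ (m - 1))"
        using r K by (intro mult_right_mono) auto
      \<comment> \<open>For \<open>m = 0\<close> both sides vanish through the factor
        \<open>real m\<close>; otherwise the exponents add.\<close>
      moreover have "r * (real m * K * r ^ (m - 1)) = real m * K * r ^ m"
        by (cases m) auto
      ultimately show ?thesis by linarith
    qed
    also have "\<dots> = (\<Sum>k=1..n. c * root q (x - real k ^ q) ^ m - real m * K * r ^ (m - 1))"
      by (simp add: sum_subtractf sum_distrib_left)
    also have "\<dots> \<le> (\<Sum>k=1..n. real (card (distinct_solutions q m (x - real k ^ q))))"
    proof (rule sum_mono)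
      fix k assume k: "k \<in> {1..n}"
      hence "x - real k ^ q \<ge> 0"
        using power_le_iff_le_floor_root[OF q x, of k] by (simp add: n_def)
      from K(2)[OF this] E[OF k]
      show "c * root q (x - real k ^ q) ^ m - real m * K * r ^ (m - 1)
          \<le> real (card (distinct_solutions q m (x - real k ^ q)))"
        by (simp add: c_def)
    qed
    also have "\<dots> \<le> real (card (distinct_solutions q (Suc m) x))
        + real m * real (card (distinct_solutions q m x))"
      using card_distinct_solutions_Suc_ge[OF q, of m x] unfolding n_def
      by (metis of_nat_add of_nat_mono of_nat_mult of_nat_sum)
    also have "real m * real (card (distinct_solutions q m x)) \<le> real m * (c * r ^ m)"
      using card_distinct_solutions_le[OF q x, of m] unfolding c_def r_def
      by (intro mult_left_mono) auto
    finally have "real (card (distinct_solutions q (Suc m) x)) \<ge> c * I - K' * r ^ m"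
      by (simp add: K'_def algebra_simps)
    moreover have "c * I = tuple_const q (Suc m) * r ^ Suc m"
      by (simp add: tuple_const_Suc[OF q] c_def I_def)
    moreover have "K' * r ^ m \<le> real (Suc m) * K' * r ^ m"
      using K' r by (intro mult_right_mono) (auto simp: algebra_simps)
    ultimately show ?thesis by (simp add: r_def)
  qed
  thus ?case using K' by (intro exI[of _ K']) auto
qed

section \<open>Passage to the limit\<close>

text \<open>After division by \<open>root q x ^ m\<close> the upper bound is the constant itself,
  and the lower bound misses it by \<open>m * K / root q x\<close>, which tends to 0.\<close>

lemma card_distinct_solutions_asymp_equiv:
  assumes q: "q \<ge> 1"
  shows "(\<lambda>x. real (card (distinct_solutions q m x)))
    \<sim>[at_top] (\<lambda>x. tuple_const q m * root q x ^ m)"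
proof (rule asymp_equivI'_const)
  obtain K where K: "\<And>x. x \<ge> 0 \<Longrightarrow> real (card (distinct_solutions q m x))
    \<ge> tuple_const q m * root q x ^ m - real m * K * root q x ^ (m - 1)"
    using card_distinct_solutions_ge[OF q, of m] by blast
  show "((\<lambda>x. real (card (distinct_solutions q m x)) / root q x ^ m) \<longlongrightarrow> tuple_const q m) at_top"
  proof (rule tendsto_sandwich)
    have "filterlim (\<lambda>x. root q x) at_top at_top"
      unfolding filterlim_at_top
    proof
      fix Z :: real
      show "\<forall>\<^sub>F x in at_top. Z \<le> root q x"
        using eventually_ge_at_top[of "max 0 Z ^ q"]
      proof eventually_elim
        case (elim x)
        have "Z \<le> root q (max 0 Z ^ q)" using q by (simp add: real_root_power_cancel)
        also have "\<dots> \<le> root q x" using elim q by (intro real_root_le_mono) auto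
        finally show ?case .
      qed
    qed
    hence "((\<lambda>x. tuple_const q m - real m * K / root q x) \<longlongrightarrow> tuple_const q m - 0) at_top"
      by (intro tendsto_diff tendsto_const real_tendsto_divide_at_top[OF tendsto_const])
    thus "((\<lambda>x. tuple_const q m - real m * K / root q x) \<longlongrightarrow> tuple_const q m) at_top" by simp
    show "\<forall>\<^sub>F x in at_top. tuple_const q m - real m * K / root q x
        \<le> real (card (distinct_solutions q m x)) / root q x ^ m"
      using eventually_gt_at_top[of 0]
    proof eventually_elim
      case (elim x)
      hence r: "root q x > 0" using q by simp
      have "tuple_const q m - real m * K / root q x
          = (tuple_const q m * root q x ^ m - real m * K * root q x ^ (m - 1)) / root q x ^ m"
        using r by (cases m) (simp_all add: field_simps)
      also have "\<dots> \<le> real (card (distinct_solutions q m x)) / root q x ^ m"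
        using K[of x] elim r by (intro divide_right_mono) auto
      finally show ?case .
    qed
    show "\<forall>\<^sub>F x in at_top. real (card (distinct_solutions q m x)) / root q x ^ m \<le> tuple_const q m"
      using eventually_gt_at_top[of 0]
    proof eventually_elim
      case (elim x)
      thus ?case using q card_distinct_solutions_le[OF q, of x m] by (simp add: divide_simps)
    qed
  qed simp
qed (use tuple_const_pos[of q m] in simp)

text \<open>Division by \<open>m!\<close> undoes the orderings, and
  \<open>Gamma (1 + m / q) = m / q * Gamma (m / q)\<close> reshapes the constant.\<close>

lemma L_asymp_equiv:
  assumes q: "q \<ge> 1" and m: "m \<ge> 1"
  shows "(\<lambda>x. real (L q m x)) \<sim>[at_top]
    (\<lambda>x. real q * Gamma (1 + 1 / real q) ^ m * x powr (real m / real q)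
          / (fact m * real m * Gamma (real m / real q)))"
proof -
  have "(\<lambda>x. real (card (distinct_solutions q m x)) / fact m)
      \<sim>[at_top] (\<lambda>x. tuple_const q m * root q x ^ m / fact m)"
    by (intro asymp_equiv_intros card_distinct_solutions_asymp_equiv q)
  also have "(\<lambda>x. real (card (distinct_solutions q m x)) / fact m) = (\<lambda>x. real (L q m x))"
    by (simp add: card_distinct_solutions[OF q])
  also have "(\<lambda>x. tuple_const q m * root q x ^ m / fact m) \<sim>[at_top]
    (\<lambda>x. real q * Gamma (1 + 1 / real q) ^ m * x powr (real m / real q)
          / (fact m * real m * Gamma (real m / real q)))"
  proof (rule asymp_equiv_refl_ev)
    have "Gamma (1 + real m / real q) = real m / real q * Gamma (real m / real q)"
      using q m Gamma_one_plus[of "real m / real q"] by simp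
    moreover have "root q x ^ m = x powr (real m / real q)" if "x > 0" for x
      using that q by (simp add: root_powr_inverse powr_power)
    ultimately show "\<forall>\<^sub>F x in at_top. tuple_const q m * root q x ^ m / fact m =
      real q * Gamma (1 + 1 / real q) ^ m * x powr (real m / real q)
          / (fact m * real m * Gamma (real m / real q))"
      using q m by (intro eventually_mono[OF eventually_gt_at_top[of 0]])
        (simp add: tuple_const_def mult_ac)
  qed
  finally show ?thesis .
qed

theorem theorem4p3:
  fixes q m :: nat
  assumes "q \<ge> 1" and "m \<ge> 1"
  shows "((\<lambda>x::real. real (L q m x)) \<sim>[at_top]
           (\<lambda>x. real q * Gamma (1 + 1 / real q) ^ m * x powr (real m / real q)
                 / (fact m * real m * Gamma (real m / real q))))
       \<and> ((\<lambda>x::real. real (L 1 m x)) \<sim>[at_top] (\<lambda>x. x ^ m / (fact m * fact m)))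
       \<and> ((\<lambda>x::real. real (L 2 m x)) \<sim>[at_top]
           (\<lambda>x. pi powr (real m / 2) * x powr (real m / 2)
                 / (2 ^ (m - 1) * fact m * real m * Gamma (real m / 2))))"
proof (intro conjI)
  note m = \<open>m \<ge> 1\<close>
  show "(\<lambda>x. real (L q m x)) \<sim>[at_top]
           (\<lambda>x. real q * Gamma (1 + 1 / real q) ^ m * x powr (real m / real q)
                 / (fact m * real m * Gamma (real m / real q)))"
    using assms by (rule L_asymp_equiv)
  \<comment> \<open>For \<open>q = 1\<close> this turns the denominator into \<open>m! * m!\<close>,
    while \<open>Gamma 2 = 1\<close> in the numerator.\<close>
  have "real m * Gamma (real m) = fact m"
    using m Gamma_one_plus[of "real m"] Gamma_fact[of m, where 'a = real] by simp
  hence "\<forall>\<^sub>F x in at_top. real 1 * Gamma (1 + 1 / real 1) ^ m * x powr (real m / real 1)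
      / (fact m * real m * Gamma (real m / real 1)) = x ^ m / (fact m * fact m)"
    by (intro eventually_mono[OF eventually_gt_at_top[of 0]])
      (simp add: powr_realpow mult.assoc Gamma_numeral)
  thus "(\<lambda>x. real (L 1 m x)) \<sim>[at_top] (\<lambda>x. x ^ m / (fact m * fact m))"
    using m by (intro asymp_equiv_trans[OF L_asymp_equiv asymp_equiv_refl_ev]) simp_all
  have G: "Gamma (1 + 1 / 2 :: real) = sqrt pi / 2"
    using Gamma_one_plus[of "1 / 2 :: real"] by (simp only: Gamma_one_half_real)
  have "sqrt pi ^ m = pi powr (real m / 2)"
    by (simp add: powr_half_sqrt[symmetric] powr_power)
  \<comment> \<open>The factor \<open>q = 2\<close> cancels one of the \<open>m\<close> halves in
    \<open>(sqrt pi / 2) ^ m\<close>; \<open>m \<ge> 1\<close> makes \<open>m - 1\<close> a true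
    difference.\<close>
  hence "2 * Gamma (1 + 1 / 2 :: real) ^ m = pi powr (real m / 2) / 2 ^ (m - 1)"
    unfolding G using m by (cases m) (simp_all add: power_divide)
  hence "(\<lambda>x. real 2 * Gamma (1 + 1 / real 2) ^ m * x powr (real m / real 2)
      / (fact m * real m * Gamma (real m / real 2)))
    = (\<lambda>x. pi powr (real m / 2) * x powr (real m / 2)
                 / (2 ^ (m - 1) * fact m * real m * Gamma (real m / 2)))"
    by (simp add: mult.assoc)
  thus "(\<lambda>x. real (L 2 m x)) \<sim>[at_top] (\<lambda>x. pi powr (real m / 2) * x powr (real m / 2)
                 / (2 ^ (m - 1) * fact m * real m * Gamma (real m / 2)))"
    using L_asymp_equiv[of 2 m] m by simp
qed

end
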